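(* Let $A$ be an $m\times m$ matrix with real coefficients and let $F_A:\mathbb{R}^m\to\mathbb{R}^m$, $F_A(x)=x+(Ax)^3$. Then: 1) If $F_A$ is not proper, then there is $x\in\mathbb{R}^m$ such that $A\big((Ax)^3\big)=0$ but $Ax\neq 0$. Moreover, such an $x$ can be chosen in $\mathrm{Im}(A^T)$. 2) For every invertible diagonal real matrix $D$, setting $B=DAD^{-3}$, the map $F_A$ is proper if and only if the map $F_B:\mathbb{R}^m\to\mathbb{R}^m$, $F_B(x)=x+(Bx)^3$, is proper. 3) $F_A$ is proper if and only if the map $\widehat{F}_A(x)=x+A(x^3)$, restricted to the linear subspace $\mathrm{Im}(AA^T)$, is proper as a map $\mathrm{Im}(AA^T)\to\mathbb{R}^m$.
   Context: For $x,y\in\mathbb{R}^m$ write $x*y=(x_1y_1,\ldots,x_my_m)$ for the coordinatewise product; powers of vectors are coordinatewise, so $x^3=x*x*x$. $A^T$ is the transpose of $A$, and $\mathrm{Im}(A)=A(\mathbb{R}^m)$. A map $F$ is proper if preimages of compact sets are compact; equivalently (for the continuous maps here), for every unbounded sequence $\{x_n\}$ in the domain, $\{F(x_n)\}$ is unbounded. *)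

theory Defs
  imports "HOL-Analysis.Analysis"
begin

text \<open>
  \<open>proper_on S f\<close> says that \<open>f\<close>, regarded as a map from the subspace \<open>S\<close> into the whole codomain,
  is proper: preimages of compact sets are compact. A subset of \<open>S\<close> is compact in the subspace
  topology of \<open>S\<close> iff it is compact in the ambient space. Continuity is not part of the definition.
  The library's \<open>proper_map\<close> is defined through closed maps instead; for continuous maps between
  metric spaces the two notions agree, see \<open>proper_on_iff_proper_map\<close> below.
\<close>

definition proper_on :: "'a::topological_space set \<Rightarrow> ('a \<Rightarrow> 'b::topological_space) \<Rightarrow> bool" where
  "proper_on S f \<longleftrightarrow> (\<forall>K. compact K \<longrightarrow> compact {x \<in> S. f x \<in> K})"

lemma proper_on_iff_proper_map:
  fixes f :: "'a::metric_space \<Rightarrow> 'b::metric_space"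
  assumes "continuous_on S f"
  shows "proper_on S f \<longleftrightarrow> proper_map (top_of_set S) euclidean f"
proof -
  have ks: "k_space (euclidean :: 'b topology)"
    by (simp add: metrizable_imp_k_space metrizable_space_euclidean)
  have kc: "kc_space (euclidean :: 'b topology)"
    by (simp add: Hausdorff_imp_kc_space)
  have "continuous_map (top_of_set S) euclidean f"
    using assms by simp
  then have "proper_map (top_of_set S) euclidean f \<longleftrightarrow>
      (\<forall>K. compactin euclidean K \<longrightarrow>
        compactin (top_of_set S) {x \<in> topspace (top_of_set S). f x \<in> K})"
    using proper_eq_compact_map[OF ks kc, of "top_of_set S" f] by auto
  then show ?thesis
    by (auto simp: proper_on_def compactin_subtopology)
qed

text \<open>
  Products and powers of vectors in \<open>real ^ 'm\<close> are coordinatewise in the library, so \<open>v ^ 3\<close> below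
  is the coordinatewise cube. The same instance makes \<open>*\<close> and \<open>^\<close> on \<open>real ^ 'm ^ 'm\<close> entrywise;
  matrix products are therefore always written with \<open>**\<close>.
\<close>

definition F_map :: "real ^ 'm ^ 'm \<Rightarrow> real ^ 'm \<Rightarrow> real ^ 'm" where
  "F_map A x = x + (A *v x) ^ 3"

definition F_hat :: "real ^ 'm ^ 'm \<Rightarrow> real ^ 'm \<Rightarrow> real ^ 'm" where
  "F_hat A x = x + A *v (x ^ 3)"

lemma vec_power_nth: "((v :: real ^ 'm) ^ n) $ i = (v $ i) ^ n"
  by (induction n) simp_all

definition matrix_image :: "real ^ 'n ^ 'm \<Rightarrow> (real ^ 'm) set" where
  "matrix_image A = range (\<lambda>x. A *v x)"

definition diagonal_matrix :: "real ^ 'm ^ 'm \<Rightarrow> bool" where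
  "diagonal_matrix D \<longleftrightarrow> (\<forall>i j. i \<noteq> j \<longrightarrow> D $ i $ j = 0)"

definition matrix_inv_cube :: "real ^ 'm ^ 'm \<Rightarrow> real ^ 'm ^ 'm" where
  "matrix_inv_cube D = matrix_inv D ** matrix_inv D ** matrix_inv D"

end

theory Submission
  imports Defs
begin

text \<open>
  Write \<open>F\<close> and \<open>H\<close> for \<open>F_map A\<close>, \<open>F_hat A\<close>. Then \<open>A (F x) = H (A x)\<close>. A solution \<open>x\<close> of \<open>F x = b\<close> is
  recovered from \<open>y = A x\<close> as \<open>x = b - y\<^sup>3\<close>, and conversely every \<open>y \<in> Im A\<close> with \<open>H y = A b\<close>
  yields the solution \<open>b - y\<^sup>3\<close>; since \<open>b\<close> can be chosen linearly in \<open>A b\<close>, boundedness of preimages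
  transfers between the two maps, which is part 3. If \<open>A (y\<^sup>3)\<close> vanishes on \<open>Im A\<close> only at \<open>0\<close>, then
  by homogeneity it grows cubically there, dominates the linear term of \<open>H\<close>, and part 1 follows.
  Part 2 holds because \<open>F_map B\<close> is the conjugate of \<open>F\<close> by \<open>D\<^sup>3\<close>.
\<close>

section \<open>Properness through bounded preimages, and under conjugation\<close>

lemma proper_on_iff_bounded_vimage:
  fixes f :: "'a::heine_borel \<Rightarrow> 'b::heine_borel"
  assumes "closed S" "continuous_on S f"
  shows "proper_on S f \<longleftrightarrow> (\<forall>B. bounded B \<longrightarrow> bounded {x \<in> S. f x \<in> B})"
proof
  assume p: "proper_on S f"
  show "\<forall>B. bounded B \<longrightarrow> bounded {x \<in> S. f x \<in> B}"
  proof (intro allI impI)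
    fix B :: "'b set"
    assume "bounded B"
    then have "compact {x \<in> S. f x \<in> closure B}"
      using p by (simp add: proper_on_def)
    moreover have "{x \<in> S. f x \<in> B} \<subseteq> {x \<in> S. f x \<in> closure B}"
      using closure_subset by auto
    ultimately show "bounded {x \<in> S. f x \<in> B}"
      using bounded_subset compact_imp_bounded by blast
  qed
next
  assume b: "\<forall>B. bounded B \<longrightarrow> bounded {x \<in> S. f x \<in> B}"
  show "proper_on S f"
    unfolding proper_on_def
  proof (intro allI impI)
    fix K :: "'b set"
    assume K: "compact K"
    \<comment> \<open>Continuity makes the preimage relatively closed in \<open>S\<close>, hence
      closed since \<open>S\<close> is; Heine-Borel leaves only boundedness to check.\<close>
    have "closed (S \<inter> f -` K)"
      using assms K by (simp add: continuous_closed_preimage compact_imp_closed)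
    moreover have "S \<inter> f -` K = {x \<in> S. f x \<in> K}"
      by auto
    ultimately show "compact {x \<in> S. f x \<in> K}"
      using b K by (simp add: compact_eq_bounded_closed)
  qed
qed

lemma proper_on_conjugate:
  fixes f :: "'a::topological_space \<Rightarrow> 'a" and g :: "'a \<Rightarrow> 'b::topological_space"
  assumes p: "proper_on UNIV f"
    and cont: "continuous_on UNIV g" "continuous_on UNIV h"
    and inv: "\<And>x. g (h x) = x" "\<And>x. h (g x) = x"
  shows "proper_on UNIV (\<lambda>x. g (f (h x)))"
  unfolding proper_on_def
proof (intro allI impI)
  fix K :: "'b set"
  assume "compact K"
  then have "compact (h ` K)"
    using cont(2) continuous_on_subset compact_continuous_image by blast
  then have "compact {y. f y \<in> h ` K}"
    using p by (simp add: proper_on_def)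
  then have "compact (g ` {y. f y \<in> h ` K})"
    using cont(1) continuous_on_subset compact_continuous_image by blast
  moreover have "{x. g (f (h x)) \<in> K} = g ` {y. f y \<in> h ` K}"
  proof safe
    fix x
    assume "g (f (h x)) \<in> K"
    then have "f (h x) \<in> h ` K"
      by (metis image_eqI inv(2))
    then show "x \<in> g ` {y. f y \<in> h ` K}"
      by (metis (mono_tags) image_eqI inv(1) mem_Collect_eq)
  qed (simp_all add: inv)
  ultimately show "compact {x \<in> UNIV. g (f (h x)) \<in> K}"
    by simp
qed

section \<open>Coordinatewise powers and matrix images: continuity and boundedness\<close>

lemma continuous_on_vec_power:
  fixes f :: "'a::topological_space \<Rightarrow> real ^ 'n"
  assumes "continuous_on S f"
  shows "continuous_on S (\<lambda>x. f x ^ k)"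
proof -
  have eq: "f x ^ k = (\<chi> i. (f x $ i) ^ k)" for x
    by (simp add: vec_eq_iff vec_power_nth)
  show ?thesis
    unfolding eq by (intro continuous_intros assms)
qed

lemma vec_power_scaleR: "(c *\<^sub>R (v :: real ^ 'n)) ^ k = c ^ k *\<^sub>R v ^ k"
  by (simp add: vec_eq_iff vec_power_nth power_mult_distrib)

lemma bounded_vec_power_image:
  fixes B :: "(real ^ 'n) set"
  assumes "bounded B"
  shows "bounded ((\<lambda>v. v ^ k) ` B)"
proof -
  \<comment> \<open>Powers are not linear in general, so boundedness comes from compactness of the
    closure.\<close>
  have "compact ((\<lambda>v. v ^ k) ` closure B)"
    using assms by (intro compact_continuous_image continuous_on_vec_power continuous_intros) simp
  then show ?thesis
    by (meson bounded_subset closure_subset compact_imp_bounded image_mono)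
qed

lemma bounded_matrix_image:
  fixes A :: "real ^ 'n ^ 'm"
  shows "bounded B \<Longrightarrow> bounded ((*v) A ` B)"
  by (simp add: bounded_linear_image matrix_vector_mul_bounded_linear)

lemma subspace_matrix_image: "subspace (matrix_image A)"
  unfolding matrix_image_def by (intro linear_subspace_image) auto

lemma continuous_on_F_map: "continuous_on S (F_map A)"
  unfolding F_map_def by (intro continuous_intros continuous_on_vec_power)

lemma continuous_on_F_hat: "continuous_on S (F_hat A)"
  unfolding F_hat_def
  by (intro continuous_intros continuous_on_vec_power
      linear_continuous_on_compose[OF _ matrix_vector_mul_linear])

section \<open>The images of A and of A A^T coincide\<close>

lemma matrix_vector_decompose:
  fixes A :: "real ^ 'n ^ 'm"
  obtains w where "A *v x = A *v (transpose A *v w)"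
proof -
  have S: "subspace (matrix_image (transpose A))"
    by (rule subspace_matrix_image)
  then have sp: "span (matrix_image (transpose A)) = matrix_image (transpose A)"
    by (rule span_eq_iff[THEN iffD2])
  obtain p q where p: "p \<in> matrix_image (transpose A)"
    and q: "\<And>z. z \<in> matrix_image (transpose A) \<Longrightarrow> orthogonal q z" and x: "x = p + q"
    using orthogonal_subspace_decomp_exists[of "matrix_image (transpose A)" x] sp by metis
  \<comment> \<open>Testing \<open>q\<close> against A^T A q gives |A q|^2 = 0: the component of
    \<open>x\<close> orthogonal to the image of A^T lies in the kernel of A.\<close>
  have "orthogonal q (transpose A *v (A *v q))"
    by (rule q) (simp add: matrix_image_def)
  then have "(A *v q) \<bullet> (A *v q) = 0"
    by (metis orthogonal_def dot_lmul_matrix vector_transpose_matrix inner_commute)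
  then have "A *v x = A *v p"
    by (simp add: x matrix_vector_right_distrib)
  with p that show thesis
    by (auto simp: matrix_image_def)
qed

lemma matrix_image_mult_transpose:
  fixes A :: "real ^ 'n ^ 'm"
  shows "matrix_image (A ** transpose A) = matrix_image A"
proof
  show "matrix_image (A ** transpose A) \<subseteq> matrix_image A"
    by (auto simp: matrix_image_def simp flip: matrix_vector_mul_assoc)
  show "matrix_image A \<subseteq> matrix_image (A ** transpose A)"
  proof
    fix y
    assume "y \<in> matrix_image A"
    then obtain x where "y = A *v x"
      by (auto simp: matrix_image_def)
    moreover obtain w where "A *v x = A *v (transpose A *v w)"
      by (rule matrix_vector_decompose)
    ultimately show "y \<in> matrix_image (A ** transpose A)"
      by (simp add: matrix_image_def del: vector_transpose_matrix flip: matrix_vector_mul_assoc)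
  qed
qed

section \<open>Transfer of properness between F and H\<close>

lemma F_hat_matrix_vector_mult: "F_hat A (A *v x) = A *v F_map A x"
  by (simp add: F_hat_def F_map_def matrix_vector_right_distrib)

text \<open>The hypothesis rearranges to y = A (b - y^3), so \<open>y\<close> lies in Im A;
  substituting this into F cancels the cubes.\<close>

lemma matrix_vector_mult_lift_F_hat:
  assumes "F_hat A y = A *v b"
  shows "A *v (b - y ^ 3) = y" and "F_map A (b - y ^ 3) = b"
proof -
  show "A *v (b - y ^ 3) = y"
    using assms by (simp add: F_hat_def matrix_vector_mult_diff_distrib flip: assms)
  then show "F_map A (b - y ^ 3) = b"
    by (simp add: F_map_def)
qed

lemma proper_F_map_iff_proper_F_hat:
  fixes A :: "real ^ 'm ^ 'm"
  shows "proper_on UNIV (F_map A) \<longleftrightarrow> proper_on (matrix_image A) (F_hat A)"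
proof -
  let ?S = "matrix_image A"
  have closed: "closed ?S"
    by (intro closed_subspace subspace_matrix_image)
  \<comment> \<open>A linear section of A over its image: in finite dimension it is bounded, so it
    sends bounded right-hand sides of H to bounded right-hand sides of F.\<close>
  obtain g where g: "linear g" and inv: "\<And>c. c \<in> ?S \<Longrightarrow> A *v g c = c"
    using linear_exists_right_inverse_on[OF matrix_vector_mul_linear subspace_UNIV, of A]
    unfolding matrix_image_def by auto
  have "(\<forall>B. bounded B \<longrightarrow> bounded {x \<in> UNIV. F_map A x \<in> B}) \<longleftrightarrow>
    (\<forall>B. bounded B \<longrightarrow> bounded {y \<in> ?S. F_hat A y \<in> B})"
  proof (intro iffI allI impI)
    fix B :: "(real ^ 'm) set"
    assume F: "\<forall>B. bounded B \<longrightarrow> bounded {x \<in> UNIV. F_map A x \<in> B}" and B: "bounded B"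
    have "bounded (g ` B)"
      using B g by (simp add: bounded_linear_image linear_conv_bounded_linear)
    then have "bounded ((*v) A ` {x. F_map A x \<in> g ` B})"
      using F by (intro bounded_matrix_image) auto
    moreover have "{y \<in> ?S. F_hat A y \<in> B} \<subseteq> (*v) A ` {x. F_map A x \<in> g ` B}"
    proof
      fix y
      assume "y \<in> {y \<in> ?S. F_hat A y \<in> B}"
      then have y: "y \<in> ?S" "F_hat A y \<in> B"
        by auto
      \<comment> \<open>Both summands of H y lie in the subspace Im A, so the section applies to H
        y. With b = g (H y), the lift b - y^3 solves F x = b and is mapped to \<open>y\<close> by
        A.\<close>
      then have "F_hat A y \<in> ?S"
        unfolding F_hat_def by (intro subspace_add subspace_matrix_image) (auto simp: matrix_image_def)
      then have "F_hat A y = A *v g (F_hat A y)"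
        by (simp add: inv)
      note x = matrix_vector_mult_lift_F_hat[OF this]
      show "y \<in> (*v) A ` {x. F_map A x \<in> g ` B}"
        using x y(2) by (metis (mono_tags) image_eqI mem_Collect_eq)
    qed
    ultimately show "bounded {y \<in> ?S. F_hat A y \<in> B}"
      by (rule bounded_subset)
  next
    fix B :: "(real ^ 'm) set"
    assume F: "\<forall>B. bounded B \<longrightarrow> bounded {y \<in> ?S. F_hat A y \<in> B}" and B: "bounded B"
    \<comment> \<open>\<open>Y\<close> contains A x for every x with F x in \<open>B\<close>. It is
      bounded by assumption, and x = F x - (A x)^3 is then a difference of elements of two bounded
      sets.\<close>
    define Y where "Y = {y \<in> ?S. F_hat A y \<in> (*v) A ` B}"
    have "bounded Y"
      unfolding Y_def using F B bounded_matrix_image by blast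
    then have "bounded ((\<lambda>(b, z). b - z) ` (B \<times> (\<lambda>y. y ^ 3) ` Y))"
      using B by (intro bounded_minus bounded_vec_power_image)
    moreover have "{x \<in> UNIV. F_map A x \<in> B} \<subseteq> (\<lambda>(b, z). b - z) ` (B \<times> (\<lambda>y. y ^ 3) ` Y)"
    proof
      fix x
      assume "x \<in> {x \<in> UNIV. F_map A x \<in> B}"
      moreover from this have "A *v x \<in> Y"
        by (auto simp: Y_def F_hat_matrix_vector_mult matrix_image_def)
      moreover have "x = F_map A x - (A *v x) ^ 3"
        by (simp add: F_map_def)
      ultimately show "x \<in> (\<lambda>(b, z). b - z) ` (B \<times> (\<lambda>y. y ^ 3) ` Y)"
        by (intro image_eqI[of _ _ "(F_map A x, (A *v x) ^ 3)"]) auto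
    qed
    ultimately show "bounded {x \<in> UNIV. F_map A x \<in> B}"
      by (rule bounded_subset)
  qed
  then show ?thesis
    by (simp add: proper_on_iff_bounded_vimage closed continuous_on_F_map continuous_on_F_hat)
qed

section \<open>Cubic growth of A (y^3) and the resulting criterion for properness\<close>

lemma cubic_lower_bound:
  fixes A :: "real ^ 'n ^ 'm"
  assumes S: "subspace S" and nz: "\<And>y. y \<in> S \<Longrightarrow> A *v (y ^ 3) = 0 \<Longrightarrow> y = 0"
  obtains c where "c > 0" "\<And>y. y \<in> S \<Longrightarrow> c * norm y ^ 3 \<le> norm (A *v (y ^ 3))"
proof (cases "S \<inter> sphere 0 1 = {}")
  \<comment> \<open>An empty unit sphere means that \<open>S\<close> is trivial; any positive
    constant serves, here 1.\<close>
  case True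
  have S0: "y = 0" if "y \<in> S" for y
  proof (rule ccontr)
    assume "y \<noteq> 0"
    then have "(1 / norm y) *\<^sub>R y \<in> S \<inter> sphere 0 1"
      using that S by (auto simp: subspace_scale)
    with True show False
      by blast
  qed
  have "1 * norm y ^ 3 \<le> norm (A *v (y ^ 3))" if "y \<in> S" for y
    using S0[OF that] by simp
  with zero_less_one show thesis
    by (rule that)
next
  case False
  let ?f = "\<lambda>u. norm (A *v (u ^ 3))"
  \<comment> \<open>The map y \<mapsto> A (y^3) is homogeneous of degree 3, so a bound on the unit
    sphere suffices. The constant is the minimum there, positive by \<open>nz\<close> since the
    minimizer is nonzero.\<close>
  have "compact (S \<inter> sphere 0 1)"
    by (intro closed_Int_compact closed_subspace S compact_sphere)
  moreover have "continuous_on (S \<inter> sphere 0 1) ?f"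
    by (intro continuous_intros continuous_on_vec_power
        linear_continuous_on_compose[OF _ matrix_vector_mul_linear])
  ultimately obtain u where u: "u \<in> S \<inter> sphere 0 1"
    and min: "\<And>v. v \<in> S \<inter> sphere 0 1 \<Longrightarrow> ?f u \<le> ?f v"
    using continuous_attains_inf[of "S \<inter> sphere 0 1" ?f] False by blast
  show thesis
  proof (rule that)
    show "?f u > 0"
      using u nz[of u] by auto
    fix y
    assume y: "y \<in> S"
    show "?f u * norm y ^ 3 \<le> ?f y"
    proof (cases "y = 0")
      case False
      define v where "v = (1 / norm y) *\<^sub>R y"
      have "v \<in> S \<inter> sphere 0 1"
        using False y S by (auto simp: v_def subspace_scale)
      moreover have "?f y = norm y ^ 3 * ?f v"
        using False by (simp add: v_def vec_power_scaleR matrix_vector_mult_scaleR power_one_over)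
      ultimately show ?thesis
        using min[of v] by (simp add: mult.commute mult_left_mono)
    qed simp
  qed
qed

text \<open>If H y stays bounded, then A (y^3) = H y - y grows at most linearly in |y|, which
  contradicts the cubic lower bound for large \<open>y\<close>.\<close>

lemma proper_F_hat:
  fixes A :: "real ^ 'm ^ 'm"
  assumes S: "subspace S" and nz: "\<And>y. y \<in> S \<Longrightarrow> A *v (y ^ 3) = 0 \<Longrightarrow> y = 0"
  shows "proper_on S (F_hat A)"
proof -
  obtain c where c: "c > 0" "\<And>y. y \<in> S \<Longrightarrow> c * norm y ^ 3 \<le> norm (A *v (y ^ 3))"
    using cubic_lower_bound[OF S nz] by blast
  have "bounded {y \<in> S. F_hat A y \<in> B}" if "bounded B" for B
  proof -
    obtain R where R: "R > 0" "\<And>b. b \<in> B \<Longrightarrow> norm b \<le> R"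
      using \<open>bounded B\<close> bounded_pos by blast
    \<comment> \<open>The 1 covers short vectors. For t = |y| > 1, c t^3 \<le> R + t \<le> (1 + R)
      t, hence c t \<le> c t^2 \<le> 1 + R.\<close>
    have "norm y \<le> max 1 ((1 + R) / c)" if y: "y \<in> S" "F_hat A y \<in> B" for y
    proof (cases "norm y \<le> 1")
      case False
      define t where "t = norm y"
      have t: "t > 1"
        using False by (simp add: t_def)
      have "norm (A *v (y ^ 3)) = norm (F_hat A y - y)"
        by (simp add: F_hat_def)
      also have "\<dots> \<le> R + t"
        unfolding t_def using R(2)[OF y(2)] norm_triangle_ineq4 by (smt (verit))
      also have "\<dots> \<le> (1 + R) * t"
        using t R(1) by (simp add: algebra_simps)
      finally have "c * t ^ 3 \<le> (1 + R) * t"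
        using c(2)[OF y(1)] by (simp add: t_def)
      then have "(c * t ^ 2) * t \<le> (1 + R) * t"
        by (simp add: power2_eq_square power3_eq_cube mult.assoc)
      then have "c * t ^ 2 \<le> 1 + R"
        using t by (simp add: mult_le_cancel_right)
      moreover have "c * t \<le> c * t ^ 2"
        using t c(1) by (simp add: power2_eq_square)
      ultimately have "c * t \<le> 1 + R"
        by (rule order_trans[rotated])
      then have "t \<le> (1 + R) / c"
        using c(1) by (simp add: pos_le_divide_eq mult.commute)
      then show ?thesis
        by (simp add: t_def)
    qed simp
    then show ?thesis
      by (intro boundedI) blast
  qed
  then show ?thesis
    unfolding proper_on_iff_bounded_vimage[OF closed_subspace[OF S] continuous_on_F_hat]
    by blast
qed

lemma F_map_not_proper_imp_kernel:
  fixes A :: "real ^ 'm ^ 'm"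
  assumes "\<not> proper_on UNIV (F_map A)"
  shows "\<exists>x \<in> matrix_image (transpose A). A *v ((A *v x) ^ 3) = 0 \<and> A *v x \<noteq> 0"
proof -
  \<comment> \<open>Describing Im A as the image of A A^T makes the kernel vector y = A (A^T w), so
    the witness x = A^T w lies in the image of A^T.\<close>
  have "\<not> proper_on (matrix_image (A ** transpose A)) (F_hat A)"
    using assms by (simp add: proper_F_map_iff_proper_F_hat matrix_image_mult_transpose)
  then obtain y where "y \<in> matrix_image (A ** transpose A)" "A *v (y ^ 3) = 0" "y \<noteq> 0"
    using proper_F_hat[OF subspace_matrix_image, of "A ** transpose A" A] by blast
  then show ?thesis
    by (auto simp: matrix_image_def simp flip: matrix_vector_mul_assoc)
qed

section \<open>Conjugation by invertible diagonal matrices\<close>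

lemma diagonal_matrix_vector_mult:
  assumes "diagonal_matrix D"
  shows "(D *v x) $ i = D $ i $ i * x $ i"
proof -
  have "(D *v x) $ i = (\<Sum>j\<in>UNIV. D $ i $ j * x $ j)"
    by (simp add: matrix_vector_mult_def)
  also have "\<dots> = (\<Sum>j\<in>UNIV. if j = i then D $ i $ i * x $ i else 0)"
    using assms by (intro sum.cong) (auto simp: diagonal_matrix_def)
  finally show ?thesis
    by simp
qed

text \<open>A diagonal matrix scales each coordinate, so cubing the vector cubes each scaling
  factor.\<close>

lemma diagonal_matrix_cube:
  assumes "diagonal_matrix D"
  shows "(D *v x) ^ 3 = D *v (D *v (D *v (x ^ 3)))"
  using assms
  by (simp add: vec_eq_iff vec_power_nth diagonal_matrix_vector_mult power3_eq_cube mult_ac)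

lemma invertible_matrix_inv_vector_mult:
  fixes D :: "real ^ 'm ^ 'm"
  assumes "invertible D"
  shows "D *v (matrix_inv D *v x) = x" and "matrix_inv D *v (D *v x) = x"
proof -
  have "D ** matrix_inv D = mat 1 \<and> matrix_inv D ** D = mat 1"
    using assms unfolding matrix_inv_def invertible_def by (rule someI_ex)
  then show "D *v (matrix_inv D *v x) = x" and "matrix_inv D *v (D *v x) = x"
    by (simp_all add: matrix_vector_mul_assoc)
qed

lemma proper_F_map_diagonal_conjugate:
  fixes A D :: "real ^ 'm ^ 'm"
  assumes D: "diagonal_matrix D" and inv: "invertible D"
  shows "proper_on UNIV (F_map A) \<longleftrightarrow> proper_on UNIV (F_map (D ** A ** matrix_inv_cube D))"
proof -
  define g h where "g = (*v) (D ** D ** D)" and "h = (*v) (matrix_inv_cube D)"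
  have gh: "g (h x) = x" and hg: "h (g x) = x" for x
    by (simp_all add: g_def h_def matrix_inv_cube_def invertible_matrix_inv_vector_mult[OF inv]
        flip: matrix_vector_mul_assoc)
  have cont: "continuous_on UNIV g" "continuous_on UNIV h"
    unfolding g_def h_def by (intro continuous_intros)+
  have B: "F_map (D ** A ** matrix_inv_cube D) x = g (F_map A (h x))" for x
  proof -
    have "F_map (D ** A ** matrix_inv_cube D) x = x + (D *v (A *v h x)) ^ 3"
      by (simp add: F_map_def h_def flip: matrix_vector_mul_assoc)
    \<comment> \<open>The linear term is rewritten as x = g (h x), while cubing turns the outer
      factor \<open>D\<close> into D^3, which is \<open>g\<close>; so \<open>g\<close> factors out
      of both terms.\<close>
    also have "\<dots> = g (h x) + g ((A *v h x) ^ 3)"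
      by (simp add: diagonal_matrix_cube[OF D] gh) (simp add: g_def flip: matrix_vector_mul_assoc)
    also have "\<dots> = g (F_map A (h x))"
      by (simp add: F_map_def g_def matrix_vector_right_distrib)
    finally show ?thesis .
  qed
  show ?thesis
  proof
    assume "proper_on UNIV (F_map A)"
    from proper_on_conjugate[OF this cont gh hg]
    show "proper_on UNIV (F_map (D ** A ** matrix_inv_cube D))"
      by (simp flip: B)
  next
    assume "proper_on UNIV (F_map (D ** A ** matrix_inv_cube D))"
    \<comment> \<open>The roles of \<open>g\<close> and \<open>h\<close> are exchanged, recovering F
      as the conjugate of F_B by the inverse.\<close>
    from proper_on_conjugate[OF this cont(2) cont(1) hg gh]
    show "proper_on UNIV (F_map A)"
      by (simp add: B hg)
  qed
qed

theorem proposition1p4: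
  fixes A :: "real ^ 'm ^ 'm"
  shows "(\<not> proper_on UNIV (F_map A) \<longrightarrow>
           (\<exists>x \<in> matrix_image (transpose A). A *v ((A *v x) ^ 3) = 0 \<and> A *v x \<noteq> 0)) \<and>
         (\<forall>D :: real ^ 'm ^ 'm. diagonal_matrix D \<and> invertible D \<longrightarrow>
           (proper_on UNIV (F_map A) \<longleftrightarrow> proper_on UNIV (F_map (D ** A ** matrix_inv_cube D)))) \<and>
         (proper_on UNIV (F_map A) \<longleftrightarrow>
           proper_on (matrix_image (A ** transpose A)) (F_hat A))"
proof (intro conjI allI impI)
  show "\<exists>x \<in> matrix_image (transpose A). A *v ((A *v x) ^ 3) = 0 \<and> A *v x \<noteq> 0"
    if "\<not> proper_on UNIV (F_map A)"
    using that by (rule F_map_not_proper_imp_kernel)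
  show "proper_on UNIV (F_map A) \<longleftrightarrow> proper_on UNIV (F_map (D ** A ** matrix_inv_cube D))"
    if "diagonal_matrix D \<and> invertible D" for D :: "real ^ 'm ^ 'm"
    using that proper_F_map_diagonal_conjugate by blast
  show "proper_on UNIV (F_map A) \<longleftrightarrow> proper_on (matrix_image (A ** transpose A)) (F_hat A)"
    by (simp add: proper_F_map_iff_proper_F_hat matrix_image_mult_transpose)
qed

end
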